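(* (1) Let $1\le p<\infty$, let $\{W_n\}_{n\in\mathbb N}$ be a sequence of metric spaces with $\operatorname{diam}(W_n)=1$ for all $n\in\mathbb N$, and let $a=\{a_n\},b=\{b_n\}\in l^p_+$ be such that $$\sup_{S\subset\mathbb N}\Biggl|\Bigl(\sum_{n\in S}|a_n|^p\Bigr)^{1/p}-\Bigl(\sum_{n\in S}|b_n|^p\Bigr)^{1/p}\Biggr|\le\bigl|\|a\|_{l^p}-\|b\|_{l^p}\bigr|.$$ Then $$2d_{GH}\Bigl((l^p)\prod_{n=1}^\infty a_nW_n,\ (l^p)\prod_{n=1}^\infty b_nW_n\Bigr)=\bigl|\|a\|_{l^p}-\|b\|_{l^p}\bigr|.$$ (2) Let $\{W_\alpha\}_{\alpha\in A}$ be an arbitrary family of metric spaces with $\operatorname{diam}(W_\alpha)=1$ for all $\alpha\in A$. Let $\{a_\alpha\}_{\alpha\in A}$, $\{b_\alpha\}_{\alpha\in A}$ be families of numbers $a_\alpha\ge0$, $b_\alpha\ge0$ with $\sup_{\alpha\in A}a_\alpha<\infty$ and $\sup_{\alpha\in A}b_\alpha<\infty$, and suppose that $$\sup_{S\subset A}\Bigl|\sup_{\beta\in S}a_\beta-\sup_{\beta\in S}b_\beta\Bigr|\le\Bigl|\sup_{\beta\in A}a_\beta-\sup_{\beta\in A}b_\beta\Bigr|.$$ Then $$2d_{GH}\Bigl((l^\infty)\prod_{\beta\in A}a_\beta W_\beta,\ (l^\infty)\prod_{\beta\in A}b_\beta W_\beta\Bigr)=\Bigl|\sup_{\beta\in A}a_\beta-\sup_{\beta\in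 A}b_\beta\Bigr|.$$
   Context: $l^p_+$ is the set of sequences $\{x_n\}_{n\in\mathbb N}\in l^p$ with $x_n\ge0$ for all $n$. $\operatorname{diam}(X)=\sup_{x,y\in X}d_X(x,y)$. The supremum (and the sum) over $S=\emptyset$ is taken to be $0$. A correspondence between $X$ and $Y$ is a subset $R\subset X\times Y$ whose projections to $X$ and to $Y$ are surjective; its distortion is $\operatorname{dis}R=\sup\{|d_X(x,x')-d_Y(y,y')| : (x,y),(x',y')\in R\}$. The Gromov--Hausdorff distance is $d_{GH}(X,Y)=\frac12\inf\{\operatorname{dis}R: R\text{ a correspondence between }X\text{ and }Y\}$. For a metric space $W=(W,d)$ and $\lambda>0$, $\lambda W$ is the space $(W,\lambda d)$. For $\lambda=0$, $0\cdot W$ denotes the set $W$ with the zero pseudometric (equivalently, for the purpose of $d_{GH}$, a one-point space). The $l^p$-product $(l^p)\prod_nX_n$ of spaces $(X_n,d_n)$ with $\sum_n(\operatorname{diam}X_n)^p<\infty$ is the Cartesian product with distance $d(\{x_n\},\{y_n\})=(\sum_nd_n(x_n,y_n)^p)^{1/p}$; the $l^\infty$-product $(l^\infty)\prod_{\alpha\in A}X_\alpha$ of spaces with $\sup_\alpha\operatorname{diam}(X_\alpha)<\infty$ is the Cartesian product with distance $\sup_{\alpha\in A}d_\alpha(x_\alpha,y_\alpha)$. *)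

theory Defs
  imports "HOL-Analysis.Analysis"
begin

text \<open>
  The \<open>\<lambda>\<close>-multiple of a metric space is only a pseudometric space when \<open>\<lambda> = 0\<close>, so the products
  below are represented as a carrier together with a distance function, rather than as elements of
  the library type of metrics.
\<close>

type_synonym 'a pmspace = "'a set \<times> ('a \<Rightarrow> 'a \<Rightarrow> real)"

definition rescale :: "real \<Rightarrow> 'a metric \<Rightarrow> 'a pmspace"
  where "rescale c W = (mspace W, \<lambda>x y. c * mdist W x y)"

text \<open>Extended values: an unbounded space has diameter \<open>\<infinity>\<close>.\<close>

definition metric_diam :: "'a metric \<Rightarrow> ennreal"
  where "metric_diam W = (SUP (x, y)\<in>mspace W \<times> mspace W. ennreal (mdist W x y))"

definition correspondence :: "'a set \<Rightarrow> 'b set \<Rightarrow> ('a \<times> 'b) set \<Rightarrow> bool"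
  where "correspondence X Y R \<longleftrightarrow> R \<subseteq> X \<times> Y \<and> fst ` R = X \<and> snd ` R = Y"

definition distortion ::
    "('a \<Rightarrow> 'a \<Rightarrow> real) \<Rightarrow> ('b \<Rightarrow> 'b \<Rightarrow> real) \<Rightarrow> ('a \<times> 'b) set \<Rightarrow> ennreal"
  where "distortion dX dY R =
    (SUP ((x, y), (x', y'))\<in>R \<times> R. ennreal \<bar>dX x x' - dY y y'\<bar>)"

definition gh_dist :: "'a pmspace \<Rightarrow> 'b pmspace \<Rightarrow> ennreal"
  where "gh_dist X Y =
    (INF R\<in>{R. correspondence (fst X) (fst Y) R}. distortion (snd X) (snd Y) R) / 2"

definition lp_nonneg :: "real \<Rightarrow> (nat \<Rightarrow> real) set"
  where "lp_nonneg p = {a. (\<forall>n. 0 \<le> a n) \<and> (\<lambda>n. \<bar>a n\<bar> powr p) summable_on UNIV}"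

text \<open>The \<open>l\<^sup>p\<close>-norm of the restriction of a sequence to \<open>S\<close>; it is \<open>0\<close> for \<open>S = {}\<close>.\<close>

definition lp_norm_on :: "real \<Rightarrow> nat set \<Rightarrow> (nat \<Rightarrow> real) \<Rightarrow> real"
  where "lp_norm_on p S a = (\<Sum>\<^sub>\<infinity>n\<in>S. \<bar>a n\<bar> powr p) powr (1 / p)"

abbreviation lp_norm :: "real \<Rightarrow> (nat \<Rightarrow> real) \<Rightarrow> real"
  where "lp_norm p a \<equiv> lp_norm_on p UNIV a"

text \<open>The supremum over the empty set, unspecified for the type of reals, is taken to be \<open>0\<close>.\<close>

definition sup0 :: "'i set \<Rightarrow> ('i \<Rightarrow> real) \<Rightarrow> real"
  where "sup0 S f = (if S = {} then 0 else (SUP i\<in>S. f i))"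

text \<open>
  The two products have their intended meaning when \<open>\<Sum>\<^sub>n (diam (X n))\<^sup>p < \<infinity>\<close>, respectively when the
  diameters are uniformly bounded: then the sum and the supremum of reals below are finite.
\<close>

definition lp_product :: "real \<Rightarrow> (nat \<Rightarrow> 'a pmspace) \<Rightarrow> (nat \<Rightarrow> 'a) pmspace"
  where "lp_product p X =
    ((\<Pi>\<^sub>E n\<in>UNIV. fst (X n)),
     \<lambda>x y. (\<Sum>\<^sub>\<infinity>n. snd (X n) (x n) (y n) powr p) powr (1 / p))"

definition linf_product :: "'i set \<Rightarrow> ('i \<Rightarrow> 'a pmspace) \<Rightarrow> ('i \<Rightarrow> 'a) pmspace"
  where "linf_product A X =
    ((\<Pi>\<^sub>E i\<in>A. fst (X i)), \<lambda>x y. sup0 A (\<lambda>i. snd (X i) (x i) (y i)))"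

end

theory Submission
  imports Defs
begin

text \<open>
  Both halves say that the Gromov--Hausdorff distance attains its universal lower bound: twice the
  distance is at least the difference of the diameters (\<open>gh_dist_lower\<close>). The diameters of the two
  products are the norms of \<open>a\<close> and of \<open>b\<close>, because every factor contains pairs of points at
  distance almost \<open>1\<close>.

  The bound is attained by the identity of the Cartesian product, a correspondence because both
  products have the same carrier. For two points at coordinate distances \<open>t\<^sub>n \<in> [0, 1]\<close> it changes
  the distance by the difference of the norms of \<open>(t\<^sub>n a\<^sub>n)\<close> and \<open>(t\<^sub>n b\<^sub>n)\<close>. The hypothesis bounds
  this difference when \<open>t\<close> is the indicator of a set \<open>S\<close>, a vertex of the cube, and what remains is
  to pass from the vertices to the whole cube.

  For finite \<open>p\<close> put \<open>A = \<Sum> \<bar>a\<^sub>n\<bar>\<^sup>p s\<^sub>n\<close> and \<open>B = \<Sum> \<bar>b\<^sub>n\<bar>\<^sup>p s\<^sub>n\<close>, which are linear in \<open>s\<^sub>n = t\<^sub>n\<^sup>p\<close>.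
  The condition \<open>A\<^bsup>1/p\<^esup> \<le> B\<^bsup>1/p\<^esup> + D\<close> reads \<open>A \<le> (B\<^bsup>1/p\<^esup> + D)\<^sup>p\<close>, and the right-hand side is a concave
  function of \<open>B\<close>. Hence the condition is a conjunction of affine inequalities in \<open>(A, B)\<close>, and each
  of these passes from vertices to the cube, a linear functional being largest on the cube at
  the indicator of the set of its positive coefficients (\<open>lp_vertex_to_cube\<close>). For the supremum norm
  the relevant vertices are the superlevel sets of \<open>t\<close> (\<open>sup0_vertex_to_cube\<close>).
\<close>

section \<open>Gromov--Hausdorff distance and diameters\<close>

lemma two_times_gh_dist:
  "2 * gh_dist X Y =
    (INF R\<in>{R. correspondence (fst X) (fst Y) R}. distortion (snd X) (snd Y) R)"
  unfolding gh_dist_def by (subst ennreal_times_divide, subst mult.commute, rule mult_divide_eq_ennreal) auto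

lemma distortion_ge:
  assumes "(x, y) \<in> R" "(x', y') \<in> R"
  shows "ennreal \<bar>dX x x' - dY y y'\<bar> \<le> distortion dX dY R"
  unfolding distortion_def
  by (rule SUP_upper2[of "((x, y), (x', y'))"]) (use assms in auto)

lemma gh_dist_upper_same_carrier:
  assumes "\<And>x y. x \<in> C \<Longrightarrow> y \<in> C \<Longrightarrow> \<bar>d x y - d' x y\<bar> \<le> D"
  shows "2 * gh_dist (C, d) (C, d') \<le> ennreal D"
proof -
  have "correspondence C C (Id_on C)"
    by (force simp: correspondence_def)
  moreover have "distortion d d' (Id_on C) \<le> ennreal D"
    unfolding distortion_def by (rule SUP_least) (auto intro!: ennreal_leI assms)
  ultimately show ?thesis
    unfolding two_times_gh_dist by (auto intro: INF_lower2)
qed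

lemma distortion_converse_le: "distortion dY dX (R\<inverse>) \<le> distortion dX dY R"
  unfolding distortion_def[of dY]
  by (rule SUP_least, clarsimp, subst abs_minus_commute, erule (1) distortion_ge)

lemma gh_dist_le_flip: "2 * gh_dist Y X \<le> 2 * gh_dist X Y"
  unfolding two_times_gh_dist
proof (rule INF_mono)
  fix R assume "R \<in> {R. correspondence (fst X) (fst Y) R}"
  then have "correspondence (fst Y) (fst X) (R\<inverse>)"
    by (auto simp: correspondence_def fst_eq_Domain snd_eq_Range)
  then show "\<exists>R'\<in>{R. correspondence (fst Y) (fst X) R}.
      distortion (snd Y) (snd X) R' \<le> distortion (snd X) (snd Y) R"
    by (intro bexI[of _ "R\<inverse>"] distortion_converse_le) simp
qed

text \<open>
  The diameter of a pseudometric space as a relation. Approximation from below is stated with a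
  factor \<open>c < 1\<close> since this is how it passes to products: pairs at distance at least \<open>c\<close> in
  all factors give a pair at distance at least \<open>c\<close> times the norm.
\<close>

definition has_diam :: "'a pmspace \<Rightarrow> real \<Rightarrow> bool"
  where "has_diam X s \<longleftrightarrow>
    (\<forall>x\<in>fst X. \<forall>y\<in>fst X. snd X x y \<le> s) \<and>
    (\<forall>c. 0 < c \<and> c < 1 \<longrightarrow> (\<exists>x\<in>fst X. \<exists>y\<in>fst X. c * s \<le> snd X x y))"

lemma gh_dist_ge_diam_diff:
  assumes X: "has_diam X s" and Y: "has_diam Y t"
  shows "ennreal (s - t) \<le> 2 * gh_dist X Y"
  unfolding two_times_gh_dist
proof (rule INF_greatest)
  fix R assume "R \<in> {R. correspondence (fst X) (fst Y) R}"
  then have R: "R \<subseteq> fst X \<times> fst Y" "fst ` R = fst X"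
    by (auto simp: correspondence_def)
  let ?E = "distortion (snd X) (snd Y) R"
  have approx: "ennreal (c * s - t) \<le> ?E" if c: "0 < c" "c < 1" for c
  proof -
    obtain x x' where x: "x \<in> fst X" "x' \<in> fst X" "c * s \<le> snd X x x'"
      using X c unfolding has_diam_def by blast
    then obtain y y' where y: "(x, y) \<in> R" "(x', y') \<in> R"
      using R(2) by (metis (no_types, lifting) fst_conv imageE prod.collapse)
    then have "snd Y y y' \<le> t"
      using Y R(1) unfolding has_diam_def by blast
    then have "ennreal (c * s - t) \<le> ennreal \<bar>snd X x x' - snd Y y y'\<bar>"
      using x(3) by (intro ennreal_leI) linarith
    also have "\<dots> \<le> ?E"
      using y by (rule distortion_ge)
    finally show ?thesis .
  qed
  show "ennreal (s - t) \<le> ?E"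
  proof (cases ?E)
    case (real r)
    have "s \<le> r + t"
    proof (rule field_le_mult_one_interval)
      fix c :: real assume "0 < c" "c < 1"
      then have "c * s - t \<le> r"
        using approx[of c] real by (simp add: ennreal_le_iff)
      then show "c * s \<le> r + t" by simp
    qed
    then show ?thesis using real by (simp add: ennreal_leI)
  qed simp
qed

lemma gh_dist_lower:
  assumes "has_diam X s" "has_diam Y t"
  shows "ennreal \<bar>s - t\<bar> \<le> 2 * gh_dist X Y"
proof (cases "t \<le> s")
  case True
  then show ?thesis using gh_dist_ge_diam_diff[OF assms] by simp
next
  case False
  then show ?thesis
    using order_trans[OF gh_dist_ge_diam_diff[OF assms(2,1)] gh_dist_le_flip] by simp
qed

lemma metric_diam_one_le:
  assumes "metric_diam W = 1" "x \<in> mspace W" "y \<in> mspace W"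
  shows "mdist W x y \<le> 1"
proof -
  have "ennreal (mdist W x y) \<le> metric_diam W"
    unfolding metric_diam_def by (rule SUP_upper2[of "(x, y)"]) (use assms in auto)
  then show ?thesis using assms(1) by (simp add: ennreal_le_1)
qed

lemma metric_diam_one_approx:
  assumes "metric_diam W = 1" "c < 1"
  shows "\<exists>x\<in>mspace W. \<exists>y\<in>mspace W. c \<le> mdist W x y"
proof -
  have "ennreal c < (SUP (x, y)\<in>mspace W \<times> mspace W. ennreal (mdist W x y))"
    using assms by (simp add: metric_diam_def[symmetric] ennreal_less_one_iff)
  then obtain x y where "x \<in> mspace W" "y \<in> mspace W" "ennreal c < ennreal (mdist W x y)"
    by (auto simp: less_SUP_iff)
  then show ?thesis
    by (meson ennreal_leI linorder_not_less nle_le)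
qed

section \<open>Norms on a cube are controlled by its vertices\<close>

text \<open>
  Convexity of \<open>x\<^sup>p\<close>, for \<open>x + y\<close> written as the convex combination \<open>l (x/l) + (1 - l) (y/(1 - l))\<close>.
  With \<open>x\<^sup>p = B\<close> the right-hand side is affine in \<open>B\<close>: it is a line above the graph of the
  concave function \<open>(B\<^bsup>1/p\<^esup> + y)\<^sup>p\<close>.
\<close>

lemma powr_add_le_weighted:
  fixes p l x y :: real
  assumes p: "1 \<le> p" and l: "0 < l" "l < 1" and xy: "0 \<le> x" "0 \<le> y"
  shows "(x + y) powr p \<le> l powr (1 - p) * x powr p + (1 - l) powr (1 - p) * y powr p"
proof -
  have w: "1 \<le> u powr (1 - p)" if "0 < u" "u < 1" for u :: real
    using powr_mono'[of "1 - p" 0 u] that p by simp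
  have scale: "u * (z / u) powr p = u powr (1 - p) * z powr p" if "0 < u" "0 \<le> z" for u z :: real
    using that by (simp add: powr_divide powr_diff)
  consider "x = 0" | "y = 0" | "0 < x" "0 < y"
    using xy by linarith
  then show ?thesis
  proof cases
    case 1
    then show ?thesis
      using mult_right_mono[OF w[of "1 - l"], of "y powr p"] l by simp
  next
    case 2
    then show ?thesis
      using mult_right_mono[OF w[of l], of "x powr p"] l by simp
  next
    case 3
    have "((1 - (1 - l)) *\<^sub>R (x / l) + (1 - l) *\<^sub>R (y / (1 - l))) powr p
        \<le> (1 - (1 - l)) * (x / l) powr p + (1 - l) * (y / (1 - l)) powr p"
      using 3 l by (intro convex_onD[OF powr_convex[OF p]]) auto
    then show ?thesis
      using l 3 by (simp add: scale)
  qed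
qed

lemma powr_add_eq_weighted:
  fixes p x y :: real
  assumes "0 < x" "0 < y"
  defines "l \<equiv> x / (x + y)"
  shows "l powr (1 - p) * x powr p + (1 - l) powr (1 - p) * y powr p = (x + y) powr p"
proof -
  have l': "1 - l = y / (x + y)"
    using assms by (simp add: l_def field_simps)
  have e: "(z / (x + y)) powr (1 - p) * z powr p = z * ((x + y) powr p / (x + y))"
    if "0 < z" for z
    using that assms(1,2) by (simp add: powr_divide powr_diff)
  have "l powr (1 - p) * x powr p + (1 - l) powr (1 - p) * y powr p
      = (x + y) * ((x + y) powr p / (x + y))"
    unfolding l' unfolding l_def using assms(1,2) by (simp add: e distrib_right add_divide_distrib)
  also have "\<dots> = (x + y) powr p"
    using assms(1,2) by simp
  finally show ?thesis .
qed

text \<open>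
  Among all \<open>s\<close> in the cube the linear functional \<open>\<Sum> (\<alpha>\<^sub>n - c \<beta>\<^sub>n) s\<^sub>n\<close> is largest at the indicator of the set
  where its coefficients are nonnegative. Choosing the vertex for each functional separately avoids
  any approximation of \<open>s\<close> by convex combinations of vertices.
\<close>

lemma affine_vertex_to_cube:
  fixes \<alpha> \<beta> s :: "'i \<Rightarrow> real"
  assumes sum: "\<alpha> summable_on UNIV" "\<beta> summable_on UNIV"
    and s: "\<And>n. 0 \<le> s n" "\<And>n. s n \<le> 1"
    and sumc: "(\<lambda>n. \<alpha> n * s n) summable_on UNIV" "(\<lambda>n. \<beta> n * s n) summable_on UNIV"
    and vertex: "\<And>S. infsum \<alpha> S \<le> c * infsum \<beta> S + C"
  shows "(\<Sum>\<^sub>\<infinity>n. \<alpha> n * s n) \<le> c * (\<Sum>\<^sub>\<infinity>n. \<beta> n * s n) + C"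
proof -
  define S where "S = {n. c * \<beta> n \<le> \<alpha> n}"
  have sumS: "\<alpha> summable_on S" "\<beta> summable_on S"
    using sum by (auto intro: summable_on_subset_banach)
  have diff: "(\<lambda>n. f n - c * g n) summable_on T"
      "(\<Sum>\<^sub>\<infinity>n\<in>T. f n - c * g n) = infsum f T - c * infsum g T"
    if "f summable_on T" "g summable_on T" for f g :: "'i \<Rightarrow> real" and T
    using summable_on_add[OF that(1) summable_on_cmult_right[OF that(2), of "- c"]]
      infsum_add[OF that(1) summable_on_cmult_right[OF that(2), of "- c"]]
      infsum_cmult_right'[of "- c" g T]
    by simp_all
  have le: "\<alpha> n * s n - c * (\<beta> n * s n) \<le> \<alpha> n - c * \<beta> n" if "n \<in> S" for n
    using mult_left_mono[of "s n" 1 "\<alpha> n - c * \<beta> n"] s that by (simp add: S_def algebra_simps)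
  have neg: "\<alpha> n * s n - c * (\<beta> n * s n) \<le> 0" if "n \<notin> S" for n
    using mult_right_mono[of "\<alpha> n" "c * \<beta> n" "s n"] s that by (simp add: S_def algebra_simps)
  have "(\<Sum>\<^sub>\<infinity>n. \<alpha> n * s n - c * (\<beta> n * s n)) \<le> (\<Sum>\<^sub>\<infinity>n\<in>S. \<alpha> n - c * \<beta> n)"
    by (rule infsum_mono_neutral) (use diff(1) sumc sumS le neg in auto)
  then show ?thesis
    using vertex[of S] by (simp add: diff(2)[OF sumc] diff(2)[OF sumS])
qed

text \<open>
  The conclusion is recovered from the affine inequalities by choosing the line tangent to
  \<open>(B\<^bsup>1/p\<^esup> + D)\<^sup>p\<close> at the point in question, whose weight is \<open>l = B\<^bsup>1/p\<^esup> / (B\<^bsup>1/p\<^esup> + D)\<close>. Increasing both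
  terms by some \<open>\<epsilon> > 0\<close> keeps this weight strictly between \<open>0\<close> and \<open>1\<close>.
\<close>

lemma lp_vertex_to_cube:
  fixes \<alpha> \<beta> s :: "'i \<Rightarrow> real"
  assumes p: "1 \<le> p" and D: "0 \<le> D"
    and sum: "\<alpha> summable_on UNIV" "\<beta> summable_on UNIV"
    and nonneg: "\<And>n. 0 \<le> \<alpha> n" "\<And>n. 0 \<le> \<beta> n"
    and s: "\<And>n. 0 \<le> s n" "\<And>n. s n \<le> 1"
    and vertex: "\<And>S. infsum \<alpha> S powr (1 / p) \<le> infsum \<beta> S powr (1 / p) + D"
  shows "(\<Sum>\<^sub>\<infinity>n. \<alpha> n * s n) powr (1 / p) \<le> (\<Sum>\<^sub>\<infinity>n. \<beta> n * s n) powr (1 / p) + D"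
proof -
  define A where "A = (\<Sum>\<^sub>\<infinity>n. \<alpha> n * s n)"
  define B where "B = (\<Sum>\<^sub>\<infinity>n. \<beta> n * s n)"
  have AB: "0 \<le> A" "0 \<le> B"
    using nonneg s by (auto simp: A_def B_def intro!: infsum_nonneg)
  have root: "(z powr (1 / p)) powr p = z" "(z powr p) powr (1 / p) = z" if "0 \<le> z" for z :: real
    using p that by (auto simp: powr_powr)
  have sumc: "(\<lambda>n. \<gamma> n * s n) summable_on UNIV"
    if "\<gamma> summable_on UNIV" "\<And>n. 0 \<le> \<gamma> n" for \<gamma> :: "'i \<Rightarrow> real"
    by (rule summable_on_comparison_test[OF that(1)]) (use s that(2) in \<open>auto intro: mult_left_le\<close>)
  have line: "A \<le> l powr (1 - p) * B + (1 - l) powr (1 - p) * D powr p"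
    if l: "0 < l" "l < 1" for l
    unfolding A_def B_def
  proof (rule affine_vertex_to_cube[OF sum s sumc[OF sum(1) nonneg(1)] sumc[OF sum(2) nonneg(2)]])
    fix S
    have pos: "0 \<le> infsum \<alpha> S" "0 \<le> infsum \<beta> S"
      using nonneg by (auto intro: infsum_nonneg)
    have "infsum \<alpha> S = (infsum \<alpha> S powr (1 / p)) powr p"
      using pos root by simp
    also have "\<dots> \<le> (infsum \<beta> S powr (1 / p) + D) powr p"
      using vertex[of S] p by (intro powr_mono2) auto
    also have "\<dots> \<le> l powr (1 - p) * (infsum \<beta> S powr (1 / p)) powr p + (1 - l) powr (1 - p) * D powr p"
      by (rule powr_add_le_weighted) (use p l D in auto)
    also have "(infsum \<beta> S powr (1 / p)) powr p = infsum \<beta> S"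
      using pos root by simp
    finally show "infsum \<alpha> S \<le> l powr (1 - p) * infsum \<beta> S + (1 - l) powr (1 - p) * D powr p" .
  qed
  have "A powr (1 / p) \<le> B powr (1 / p) + D"
  proof (rule field_le_epsilon)
    fix e :: real assume e: "0 < e"
    define x where "x = B powr (1 / p) + e / 2"
    define y where "y = D + e / 2"
    define l where "l = x / (x + y)"
    have xy: "0 < x" "0 < y"
      using e D AB by (auto simp: x_def y_def add_nonneg_pos)
    then have l: "0 < l" "l < 1"
      by (auto simp: l_def)
    have "B \<le> x powr p"
      using powr_mono2[of p "B powr (1 / p)" x] p e root(1)[OF AB(2)] by (simp add: x_def)
    moreover have "D powr p \<le> y powr p"
      using p e D by (intro powr_mono2) (auto simp: y_def)
    ultimately have "l powr (1 - p) * B + (1 - l) powr (1 - p) * D powr p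
        \<le> l powr (1 - p) * x powr p + (1 - l) powr (1 - p) * y powr p"
      by (intro add_mono mult_left_mono) auto
    also have "\<dots> = (x + y) powr p"
      unfolding l_def using xy by (rule powr_add_eq_weighted)
    finally have "A \<le> (x + y) powr p"
      using line[OF l] by linarith
    then have "A powr (1 / p) \<le> ((x + y) powr p) powr (1 / p)"
      using AB p by (intro powr_mono2) auto
    then show "A powr (1 / p) \<le> B powr (1 / p) + D + e"
      using root(2)[of "x + y"] xy by (simp add: x_def y_def)
  qed
  then show ?thesis by (simp add: A_def B_def)
qed

lemma sup0_upper: "i \<in> S \<Longrightarrow> bdd_above (f ` S) \<Longrightarrow> f i \<le> sup0 S f"
  by (auto simp: sup0_def intro: cSUP_upper)

lemma sup0_least: "(\<And>i. i \<in> S \<Longrightarrow> f i \<le> M) \<Longrightarrow> 0 \<le> M \<Longrightarrow> sup0 S f \<le> M"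
  by (auto simp: sup0_def intro: cSUP_least)

lemma sup0_nonneg:
  assumes "\<And>i. i \<in> S \<Longrightarrow> 0 \<le> f i" "bdd_above (f ` S)"
  shows "0 \<le> sup0 S f"
proof (cases "S = {}")
  case False
  then obtain i where "i \<in> S" by blast
  then show ?thesis using assms sup0_upper[of i S f] by force
qed (simp add: sup0_def)

lemma sup0_mono_set:
  assumes "\<And>i. i \<in> A \<Longrightarrow> 0 \<le> f i" "bdd_above (f ` A)" "S \<subseteq> A"
  shows "sup0 S f \<le> sup0 A f"
  using assms by (auto intro!: sup0_least sup0_nonneg sup0_upper)

lemma bdd_above_contraction:
  fixes f :: "'i \<Rightarrow> real"
  assumes "bdd_above (f ` A)" "\<And>i. i \<in> A \<Longrightarrow> 0 \<le> f i" "\<And>i. i \<in> A \<Longrightarrow> t i \<le> 1"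
  shows "bdd_above ((\<lambda>i. f i * t i) ` A)"
proof -
  obtain M where "\<And>i. i \<in> A \<Longrightarrow> f i \<le> M"
    using assms(1) by (auto simp: bdd_above_def)
  then show ?thesis
    using assms(2,3) by (intro bdd_aboveI2[of _ _ M]) (meson mult_left_le order_trans)
qed

text \<open>
  To bound \<open>a\<^sub>i t\<^sub>i\<close> the hypothesis is applied to \<open>S = {j. t\<^sub>i \<le> t\<^sub>j}\<close>, on which \<open>b\<^sub>j t\<^sub>i \<le> b\<^sub>j t\<^sub>j\<close>: from
  \<open>a\<^sub>i \<le> sup\<^sub>S b + D\<close> one gets \<open>a\<^sub>i t\<^sub>i \<le> sup (b t) + D t\<^sub>i\<close>.
\<close>

lemma sup0_vertex_to_cube:
  fixes a b t :: "'i \<Rightarrow> real"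
  assumes D: "0 \<le> D"
    and a: "bdd_above (a ` A)"
    and b: "\<And>i. i \<in> A \<Longrightarrow> 0 \<le> b i" "bdd_above (b ` A)"
    and t: "\<And>i. i \<in> A \<Longrightarrow> 0 \<le> t i" "\<And>i. i \<in> A \<Longrightarrow> t i \<le> 1"
    and vertex: "\<And>S. S \<subseteq> A \<Longrightarrow> sup0 S a \<le> sup0 S b + D"
  shows "sup0 A (\<lambda>i. a i * t i) \<le> sup0 A (\<lambda>i. b i * t i) + D"
proof -
  define M where "M = sup0 A (\<lambda>i. b i * t i)"
  have bdd: "bdd_above ((\<lambda>i. b i * t i) ` A)"
    by (rule bdd_above_contraction) (use b t in auto)
  have M: "0 \<le> M"
    unfolding M_def by (rule sup0_nonneg[OF _ bdd]) (use b t in auto)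
  have "a i * t i \<le> M + D" if i: "i \<in> A" for i
  proof (cases "t i = 0")
    case False
    then have ti: "0 < t i" using t i by force
    define S where "S = {j \<in> A. t i \<le> t j}"
    have "sup0 S b \<le> M / t i"
    proof (rule sup0_least)
      fix j assume "j \<in> S"
      then have j: "j \<in> A" "t i \<le> t j" by (auto simp: S_def)
      have "b j * t i \<le> b j * t j"
        using j b by (intro mult_left_mono) auto
      also have "\<dots> \<le> M"
        unfolding M_def by (rule sup0_upper[OF j(1) bdd])
      finally show "b j \<le> M / t i"
        using ti by (simp add: field_simps)
    qed (use M ti in auto)
    moreover have "a i \<le> sup0 S a"
      by (rule sup0_upper) (use i a in \<open>auto simp: S_def intro: bdd_above_mono\<close>)
    moreover have "sup0 S a \<le> sup0 S b + D"
      by (rule vertex) (auto simp: S_def)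
    ultimately have "a i \<le> M / t i + D" by linarith
    then have "a i * t i \<le> (M / t i + D) * t i"
      using ti by (intro mult_right_mono) auto
    also have "\<dots> = M + D * t i"
      using ti by (simp add: field_simps)
    also have "\<dots> \<le> M + D"
      using D t(2)[OF i] by (simp add: mult_left_le)
    finally show ?thesis .
  qed (use M D in auto)
  then show ?thesis
    unfolding M_def[symmetric] using M D by (intro sup0_least) auto
qed

section \<open>Products of rescaled spaces of diameter one\<close>

lemma lp_product_rescale:
  assumes "\<And>n. 0 \<le> a n"
  shows "lp_product p (\<lambda>n. rescale (a n) (W n)) =
    (\<Pi>\<^sub>E n\<in>UNIV. mspace (W n),
     \<lambda>x y. (\<Sum>\<^sub>\<infinity>n. \<bar>a n\<bar> powr p * mdist (W n) (x n) (y n) powr p) powr (1 / p))"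
  using assms by (simp add: lp_product_def rescale_def powr_mult)

lemma linf_product_rescale:
  "linf_product A (\<lambda>i. rescale (a i) (W i)) =
    (\<Pi>\<^sub>E i\<in>A. mspace (W i), \<lambda>x y. sup0 A (\<lambda>i. a i * mdist (W i) (x i) (y i)))"
  by (simp add: linf_product_def rescale_def)

lemma obtain_almost_diametral_points:
  assumes "\<And>i. i \<in> A \<Longrightarrow> metric_diam (W i) = 1" "c < 1"
  obtains x y where "x \<in> (\<Pi>\<^sub>E i\<in>A. mspace (W i))" "y \<in> (\<Pi>\<^sub>E i\<in>A. mspace (W i))"
    "\<And>i. i \<in> A \<Longrightarrow> c \<le> mdist (W i) (x i) (y i)"
proof -
  have "\<forall>i\<in>A. \<exists>z. fst z \<in> mspace (W i) \<and> snd z \<in> mspace (W i) \<and> c \<le> mdist (W i) (fst z) (snd z)"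
    using metric_diam_one_approx assms by fastforce
  then obtain z where "\<forall>i\<in>A. fst (z i) \<in> mspace (W i) \<and> snd (z i) \<in> mspace (W i)
      \<and> c \<le> mdist (W i) (fst (z i)) (snd (z i))"
    by metis
  then show thesis
    by (intro that[of "restrict (\<lambda>i. fst (z i)) A" "restrict (\<lambda>i. snd (z i)) A"]) auto
qed

lemma has_diam_lp_product:
  fixes W :: "nat \<Rightarrow> 'a metric"
  assumes p: "1 \<le> p" and W: "\<And>n. metric_diam (W n) = 1" and a: "a \<in> lp_nonneg p"
  shows "has_diam (lp_product p (\<lambda>n. rescale (a n) (W n))) (lp_norm p a)"
proof -
  have a0: "\<And>n. 0 \<le> a n" and sum: "(\<lambda>n. \<bar>a n\<bar> powr p) summable_on UNIV"
    using a by (auto simp: lp_nonneg_def)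
  let ?C = "\<Pi>\<^sub>E n\<in>UNIV. mspace (W n)"
  let ?f = "\<lambda>x y n. \<bar>a n\<bar> powr p * mdist (W n) (x n) (y n) powr p"
  have le: "?f x y n \<le> \<bar>a n\<bar> powr p" if "x \<in> ?C" "y \<in> ?C" for x y n
    using metric_diam_one_le[OF W, of "x n" n "y n"] p that
    by (intro mult_left_le powr_le1) auto
  have sumf: "?f x y summable_on UNIV" if "x \<in> ?C" "y \<in> ?C" for x y
    by (rule summable_on_comparison_test[OF sum]) (use le[OF that] in auto)
  have upper: "(\<Sum>\<^sub>\<infinity>n. ?f x y n) powr (1 / p) \<le> lp_norm p a" if "x \<in> ?C" "y \<in> ?C" for x y
    unfolding lp_norm_on_def
    using le[OF that] sumf[OF that] sum p by (intro powr_mono2 infsum_mono infsum_nonneg) auto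
  have lower: "\<exists>x\<in>?C. \<exists>y\<in>?C. c * lp_norm p a \<le> (\<Sum>\<^sub>\<infinity>n. ?f x y n) powr (1 / p)"
    if c: "0 < c" "c < 1" for c
  proof -
    obtain x y where xy: "x \<in> ?C" "y \<in> ?C" "\<And>n. c \<le> mdist (W n) (x n) (y n)"
      using obtain_almost_diametral_points[of UNIV W c] W c by auto
    have "c * lp_norm p a = (c powr p * (\<Sum>\<^sub>\<infinity>n. \<bar>a n\<bar> powr p)) powr (1 / p)"
      using c p by (simp add: lp_norm_on_def powr_mult powr_powr infsum_nonneg)
    also have "\<dots> = (\<Sum>\<^sub>\<infinity>n. c powr p * \<bar>a n\<bar> powr p) powr (1 / p)"
      by (simp add: infsum_cmult_right')
    also have "\<dots> \<le> (\<Sum>\<^sub>\<infinity>n. ?f x y n) powr (1 / p)"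
    proof (intro powr_mono2 infsum_mono infsum_nonneg)
      show "c powr p * \<bar>a n\<bar> powr p \<le> ?f x y n" for n
        using xy(3)[of n] c p by (subst mult.commute) (intro mult_left_mono powr_mono2, auto)
    qed (use p sum sumf[OF xy(1,2)] in \<open>auto intro: summable_on_cmult_right\<close>)
    finally show ?thesis using xy by blast
  qed
  show ?thesis
    unfolding has_diam_def lp_product_rescale[OF a0] fst_conv snd_conv
    by (intro conjI ballI allI impI; (elim conjE)?; rule upper lower; assumption)
qed

lemma has_diam_linf_product:
  fixes W :: "'i \<Rightarrow> 'b metric"
  assumes W: "\<And>i. i \<in> A \<Longrightarrow> metric_diam (W i) = 1"
    and a: "\<And>i. i \<in> A \<Longrightarrow> 0 \<le> a i" "bdd_above (a ` A)"
  shows "has_diam (linf_product A (\<lambda>i. rescale (a i) (W i))) (sup0 A a)"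
proof -
  let ?C = "\<Pi>\<^sub>E i\<in>A. mspace (W i)"
  let ?f = "\<lambda>x y i. a i * mdist (W i) (x i) (y i)"
  have d1: "mdist (W i) (x i) (y i) \<le> 1" if "x \<in> ?C" "y \<in> ?C" "i \<in> A" for x y i
    using metric_diam_one_le[OF W[OF that(3)], of "x i" "y i"] that by (auto simp: PiE_iff)
  have upper: "sup0 A (?f x y) \<le> sup0 A a" if "x \<in> ?C" "y \<in> ?C" for x y
  proof (rule sup0_least)
    fix i assume i: "i \<in> A"
    have "?f x y i \<le> a i"
      using d1[OF that i] a(1)[OF i] by (intro mult_left_le) auto
    then show "?f x y i \<le> sup0 A a"
      using sup0_upper[OF i a(2)] by simp
  qed (use a sup0_nonneg in blast)
  have lower: "\<exists>x\<in>?C. \<exists>y\<in>?C. c * sup0 A a \<le> sup0 A (?f x y)" if c: "0 < c" "c < 1" for c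
  proof -
    obtain x y where xy: "x \<in> ?C" "y \<in> ?C" "\<And>i. i \<in> A \<Longrightarrow> c \<le> mdist (W i) (x i) (y i)"
      using obtain_almost_diametral_points[of A W c] W c by auto
    have bdd: "bdd_above (?f x y ` A)"
      by (rule bdd_above_contraction) (use a d1[OF xy(1,2)] in auto)
    have "sup0 A a \<le> sup0 A (?f x y) / c"
    proof (rule sup0_least)
      fix i assume i: "i \<in> A"
      have "a i * c \<le> ?f x y i"
        using xy(3)[OF i] a(1)[OF i] by (rule mult_left_mono)
      also have "\<dots> \<le> sup0 A (?f x y)"
        by (rule sup0_upper[OF i bdd])
      finally show "a i \<le> sup0 A (?f x y) / c"
        using c by (simp add: field_simps)
    next
      show "0 \<le> sup0 A (?f x y) / c"
        using c a(1) by (intro divide_nonneg_pos sup0_nonneg[OF _ bdd]) auto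
    qed
    then show ?thesis using xy(1,2) c by (force simp: field_simps)
  qed
  show ?thesis
    unfolding has_diam_def linf_product_rescale fst_conv snd_conv
    by (intro conjI ballI allI impI; (elim conjE)?; rule upper lower; assumption)
qed

lemma lp_norm_on_mono_set:
  assumes p: "1 \<le> p" and a: "a \<in> lp_nonneg p"
  shows "lp_norm_on p S a \<le> lp_norm p a"
  unfolding lp_norm_on_def
proof (intro powr_mono2 infsum_mono2 infsum_nonneg)
  show sum: "(\<lambda>n. \<bar>a n\<bar> powr p) summable_on UNIV"
    using a unfolding lp_nonneg_def by blast
  show "(\<lambda>n. \<bar>a n\<bar> powr p) summable_on S"
    by (rule summable_on_subset_banach[OF sum]) simp
qed (use p in auto)

theorem gh_dist_lp_product:
  fixes W :: "nat \<Rightarrow> 'a metric"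
  assumes p: "1 \<le> p" and W: "\<And>n. metric_diam (W n) = 1"
    and a: "a \<in> lp_nonneg p" and b: "b \<in> lp_nonneg p"
    and vertex: "(SUP S\<in>Pow UNIV. \<bar>lp_norm_on p S a - lp_norm_on p S b\<bar>)
      \<le> \<bar>lp_norm p a - lp_norm p b\<bar>"
  shows "2 * gh_dist (lp_product p (\<lambda>n. rescale (a n) (W n)))
      (lp_product p (\<lambda>n. rescale (b n) (W n))) = ennreal \<bar>lp_norm p a - lp_norm p b\<bar>"
proof (rule antisym)
  define D where "D = \<bar>lp_norm p a - lp_norm p b\<bar>"
  have a': "\<And>n. 0 \<le> a n" "(\<lambda>n. \<bar>a n\<bar> powr p) summable_on UNIV"
    and b': "\<And>n. 0 \<le> b n" "(\<lambda>n. \<bar>b n\<bar> powr p) summable_on UNIV"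
    using a b by (auto simp: lp_nonneg_def)
  have "bdd_above ((\<lambda>S. \<bar>lp_norm_on p S a - lp_norm_on p S b\<bar>) ` Pow UNIV)"
  proof (rule bdd_aboveI2)
    show "\<bar>lp_norm_on p S a - lp_norm_on p S b\<bar> \<le> lp_norm p a + lp_norm p b" for S
      using lp_norm_on_mono_set[OF p a, of S] lp_norm_on_mono_set[OF p b, of S]
        powr_ge_zero[of "\<Sum>\<^sub>\<infinity>n\<in>S. \<bar>a n\<bar> powr p" "1 / p"]
        powr_ge_zero[of "\<Sum>\<^sub>\<infinity>n\<in>S. \<bar>b n\<bar> powr p" "1 / p"]
      unfolding lp_norm_on_def by linarith
  qed
  then have bound: "\<bar>lp_norm_on p S a - lp_norm_on p S b\<bar> \<le> D" for S
    using vertex cSUP_upper[of S "Pow UNIV"] unfolding D_def by fastforce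
  have v: "lp_norm_on p S a \<le> lp_norm_on p S b + D"
      "lp_norm_on p S b \<le> lp_norm_on p S a + D" for S
    using bound[of S] by linarith+
  show "2 * gh_dist (lp_product p (\<lambda>n. rescale (a n) (W n)))
      (lp_product p (\<lambda>n. rescale (b n) (W n))) \<le> ennreal \<bar>lp_norm p a - lp_norm p b\<bar>"
    unfolding lp_product_rescale[OF a'(1)] lp_product_rescale[OF b'(1)]
  proof (rule gh_dist_upper_same_carrier)
    fix x y assume xy: "x \<in> (\<Pi>\<^sub>E n\<in>UNIV. mspace (W n))" "y \<in> (\<Pi>\<^sub>E n\<in>UNIV. mspace (W n))"
    let ?s = "\<lambda>n. mdist (W n) (x n) (y n) powr p"
    have "mdist (W n) (x n) (y n) \<le> 1" for n
      using xy by (intro metric_diam_one_le W) auto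
    then have s: "0 \<le> ?s n" "?s n \<le> 1" for n
      using p by (simp_all add: powr_le1)
    have D: "0 \<le> D" by (simp add: D_def)
    have "(\<Sum>\<^sub>\<infinity>n. \<bar>a n\<bar> powr p * ?s n) powr (1 / p)
        \<le> (\<Sum>\<^sub>\<infinity>n. \<bar>b n\<bar> powr p * ?s n) powr (1 / p) + D"
      using v(1) by (intro lp_vertex_to_cube p D a' b' s) (auto simp: lp_norm_on_def)
    moreover have "(\<Sum>\<^sub>\<infinity>n. \<bar>b n\<bar> powr p * ?s n) powr (1 / p)
        \<le> (\<Sum>\<^sub>\<infinity>n. \<bar>a n\<bar> powr p * ?s n) powr (1 / p) + D"
      using v(2) by (intro lp_vertex_to_cube p D a' b' s) (auto simp: lp_norm_on_def)
    ultimately show "\<bar>(\<Sum>\<^sub>\<infinity>n. \<bar>a n\<bar> powr p * ?s n) powr (1 / p)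
        - (\<Sum>\<^sub>\<infinity>n. \<bar>b n\<bar> powr p * ?s n) powr (1 / p)\<bar> \<le> \<bar>lp_norm p a - lp_norm p b\<bar>"
      unfolding D_def[symmetric] by linarith
  qed
  show "ennreal \<bar>lp_norm p a - lp_norm p b\<bar> \<le> 2 * gh_dist (lp_product p (\<lambda>n. rescale (a n) (W n)))
      (lp_product p (\<lambda>n. rescale (b n) (W n)))"
    by (rule gh_dist_lower[OF has_diam_lp_product[OF p W a] has_diam_lp_product[OF p W b]])
qed

theorem gh_dist_linf_product:
  fixes W :: "'i \<Rightarrow> 'b metric"
  assumes W: "\<And>i. i \<in> A \<Longrightarrow> metric_diam (W i) = 1"
    and a: "\<And>i. i \<in> A \<Longrightarrow> 0 \<le> a i" "bdd_above (a ` A)"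
    and b: "\<And>i. i \<in> A \<Longrightarrow> 0 \<le> b i" "bdd_above (b ` A)"
    and vertex: "(SUP S\<in>Pow A. \<bar>sup0 S a - sup0 S b\<bar>) \<le> \<bar>sup0 A a - sup0 A b\<bar>"
  shows "2 * gh_dist (linf_product A (\<lambda>i. rescale (a i) (W i)))
      (linf_product A (\<lambda>i. rescale (b i) (W i))) = ennreal \<bar>sup0 A a - sup0 A b\<bar>"
proof (rule antisym)
  define D where "D = \<bar>sup0 A a - sup0 A b\<bar>"
  have range: "0 \<le> sup0 S f" "sup0 S f \<le> sup0 A f"
    if "S \<subseteq> A" "\<And>i. i \<in> A \<Longrightarrow> 0 \<le> f i" "bdd_above (f ` A)" for S and f :: "'i \<Rightarrow> real"
    using that sup0_mono_set[of A f S]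
    by (auto intro!: sup0_nonneg bdd_above_mono[OF that(3)])
  have "bdd_above ((\<lambda>S. \<bar>sup0 S a - sup0 S b\<bar>) ` Pow A)"
  proof (rule bdd_aboveI2)
    show "\<bar>sup0 S a - sup0 S b\<bar> \<le> sup0 A a + sup0 A b" if "S \<in> Pow A" for S
      using range[of S a] range[of S b] a b that by auto
  qed
  then have bound: "\<bar>sup0 S a - sup0 S b\<bar> \<le> D" if "S \<subseteq> A" for S
    using vertex cSUP_upper[of S "Pow A"] that unfolding D_def by fastforce
  have v: "sup0 S a \<le> sup0 S b + D" "sup0 S b \<le> sup0 S a + D" if "S \<subseteq> A" for S
    using bound[OF that] by linarith+
  show "2 * gh_dist (linf_product A (\<lambda>i. rescale (a i) (W i)))
      (linf_product A (\<lambda>i. rescale (b i) (W i))) \<le> ennreal \<bar>sup0 A a - sup0 A b\<bar>"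
    unfolding linf_product_rescale
  proof (rule gh_dist_upper_same_carrier)
    fix x y assume xy: "x \<in> (\<Pi>\<^sub>E i\<in>A. mspace (W i))" "y \<in> (\<Pi>\<^sub>E i\<in>A. mspace (W i))"
    let ?t = "\<lambda>i. mdist (W i) (x i) (y i)"
    have t: "0 \<le> ?t i" "?t i \<le> 1" if "i \<in> A" for i
      using metric_diam_one_le[OF W[OF that], of "x i" "y i"] xy that by (auto simp: PiE_iff)
    have D: "0 \<le> D" by (simp add: D_def)
    have "sup0 A (\<lambda>i. a i * ?t i) \<le> sup0 A (\<lambda>i. b i * ?t i) + D"
      by (intro sup0_vertex_to_cube D a b t v)
    moreover have "sup0 A (\<lambda>i. b i * ?t i) \<le> sup0 A (\<lambda>i. a i * ?t i) + D"
      by (intro sup0_vertex_to_cube D a b t v)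
    ultimately show "\<bar>sup0 A (\<lambda>i. a i * ?t i) - sup0 A (\<lambda>i. b i * ?t i)\<bar> \<le> \<bar>sup0 A a - sup0 A b\<bar>"
      unfolding D_def[symmetric] by linarith
  qed
  show "ennreal \<bar>sup0 A a - sup0 A b\<bar> \<le> 2 * gh_dist (linf_product A (\<lambda>i. rescale (a i) (W i)))
      (linf_product A (\<lambda>i. rescale (b i) (W i)))"
    by (rule gh_dist_lower[OF has_diam_linf_product[OF W a] has_diam_linf_product[OF W b]])
qed

theorem theorem3p11:
  shows
    "(\<forall>(p::real) (W :: nat \<Rightarrow> 'a metric) (a :: nat \<Rightarrow> real) (b :: nat \<Rightarrow> real).
        1 \<le> p \<and>
        (\<forall>n. metric_diam (W n) = 1) \<and>
        a \<in> lp_nonneg p \<and> b \<in> lp_nonneg p \<and>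
        (SUP S\<in>Pow UNIV. \<bar>lp_norm_on p S a - lp_norm_on p S b\<bar>) \<le> \<bar>lp_norm p a - lp_norm p b\<bar>
        \<longrightarrow>
        2 * gh_dist (lp_product p (\<lambda>n. rescale (a n) (W n)))
                    (lp_product p (\<lambda>n. rescale (b n) (W n)))
          = ennreal \<bar>lp_norm p a - lp_norm p b\<bar>)
     \<and>
     (\<forall>(A :: 'i set) (W :: 'i \<Rightarrow> 'b metric) (a :: 'i \<Rightarrow> real) (b :: 'i \<Rightarrow> real).
        (\<forall>\<alpha>\<in>A. metric_diam (W \<alpha>) = 1) \<and>
        (\<forall>\<alpha>\<in>A. 0 \<le> a \<alpha>) \<and> (\<forall>\<alpha>\<in>A. 0 \<le> b \<alpha>) \<and>
        bdd_above (a ` A) \<and> bdd_above (b ` A) \<and>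
        (SUP S\<in>Pow A. \<bar>sup0 S a - sup0 S b\<bar>) \<le> \<bar>sup0 A a - sup0 A b\<bar>
        \<longrightarrow>
        2 * gh_dist (linf_product A (\<lambda>\<beta>. rescale (a \<beta>) (W \<beta>)))
                    (linf_product A (\<lambda>\<beta>. rescale (b \<beta>) (W \<beta>)))
          = ennreal \<bar>sup0 A a - sup0 A b\<bar>)"
proof (rule conjI; intro allI impI; elim conjE)
  fix p :: real and W :: "nat \<Rightarrow> 'a metric" and a b :: "nat \<Rightarrow> real"
  assume h: "1 \<le> p" "\<forall>n. metric_diam (W n) = 1" "a \<in> lp_nonneg p" "b \<in> lp_nonneg p"
      "(SUP S\<in>Pow UNIV. \<bar>lp_norm_on p S a - lp_norm_on p S b\<bar>) \<le> \<bar>lp_norm p a - lp_norm p b\<bar>"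
  show "2 * gh_dist (lp_product p (\<lambda>n. rescale (a n) (W n)))
      (lp_product p (\<lambda>n. rescale (b n) (W n))) = ennreal \<bar>lp_norm p a - lp_norm p b\<bar>"
    by (rule gh_dist_lp_product[OF h(1) spec[OF h(2)] h(3-5)])
next
  fix A :: "'i set" and W :: "'i \<Rightarrow> 'b metric" and a b :: "'i \<Rightarrow> real"
  assume h: "\<forall>\<alpha>\<in>A. metric_diam (W \<alpha>) = 1" "\<forall>\<alpha>\<in>A. 0 \<le> a \<alpha>" "\<forall>\<alpha>\<in>A. 0 \<le> b \<alpha>"
      "bdd_above (a ` A)" "bdd_above (b ` A)"
      "(SUP S\<in>Pow A. \<bar>sup0 S a - sup0 S b\<bar>) \<le> \<bar>sup0 A a - sup0 A b\<bar>"
  show "2 * gh_dist (linf_product A (\<lambda>\<beta>. rescale (a \<beta>) (W \<beta>)))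
      (linf_product A (\<lambda>\<beta>. rescale (b \<beta>) (W \<beta>))) = ennreal \<bar>sup0 A a - sup0 A b\<bar>"
    by (rule gh_dist_linf_product; (erule h(1-3)[rule_format] | rule h(4-6)))
qed

end
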